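(* Let $\Gamma$ be the complex projective plane with the rational maps $\pi,\tau$, the conics $\mathcal{C}_q$ and the parametrisations $t\mapsto P_q(t)$, $t\in\mathbb{P}^1$, defined in the context. Put $$\imath(t)=\frac{19t-23}{16t-19},\qquad \beta(t)=\frac{44t^2-76t+27}{56t^2-120t+62}.$$ Then $\tau(\mathcal{C}_{2/7})=\mathcal{C}_{2/7}$ and $\pi(\mathcal{C}_{2/7})=\mathcal{C}_{-1/4}$. Moreover, for all $t\in\mathbb{P}^1$, $$\tau(P_{2/7}(t))=P_{2/7}(\imath(t))\quad\text{and}\quad \pi(P_{2/7}(t))=P_{-1/4}(\beta(t)).$$
   Context: Work over $\mathbb{C}$. $\Gamma$ is the projective plane with homogeneous coordinates $[x,y,z]$, and $$\pi([x,y,z])=[2y(y-x+2z),\,y^2,\,(x-y)^2],\qquad \tau([x,y,z])=[2y-x,\,y,\,y-x+z]$$ (rational maps $\Gamma\dashrightarrow\Gamma$). Let $R_1=[2,1,1]$, $R_2=[12,16,1]$, $R_3=[5,4,1]$, $R_4=[8,16,1]$. Cross-ratio convention: $\langle x_1,x_2,x_3,x_4\rangle=\frac{(x_1-x_3)(x_2-x_4)}{(x_2-x_3)(x_1-x_4)}$ on $\mathbb{P}^1$; for four lines through a common point, use any projective isomorphism of the pencil of lines through that point with $\mathbb{P}^1$. Conics: on any smooth conic through $R_1,\dots,R_4$ the cross-ratio $\langle PR_1,PR_2,PR_3,PR_4\rangle$ is independent of the point $P$ of the conic (limiting values being taken when $P$ is one of the $R_i$), and this value determines the conic in the pencil of conics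 through $R_1,\dots,R_4$. For $q\neq 0,1,\infty$, $\mathcal{C}_q$ denotes the smooth conic through $R_1,\dots,R_4$ whose value is $q$, i.e. $\mathcal{C}_q=\{P\in\Gamma:\langle PR_1,PR_2,PR_3,PR_4\rangle=q\}$. Parametrisation: for $t\in\mathbb{C}$ let $L_t$ be the line $tx-y+(1-2t)z=0$ through $R_1$, and let $L_\infty$ be the line $x-2z=0$. For $t\in\mathbb{P}^1=\mathbb{C}\cup\{\infty\}$, $P_q(t)$ is the point such that $\mathcal{C}_q$ and $L_t$ intersect in the point-pair $R_1,P_q(t)$ (counted with multiplicity, so $P_q(t)=R_1$ if $L_t$ is tangent to $\mathcal{C}_q$ at $R_1$). The map $t\mapsto P_q(t)$ is an isomorphism $\mathbb{P}^1\to\mathcal{C}_q$. *)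

theory Defs
  imports
    "HOL-Analysis.Analysis"
    "HOL-Computational_Algebra.Polynomial"
    "HOL-Library.Multiset"
begin

section \<open>The projective line and the projective plane\<close>

datatype p1 = Aff complex | Infty

text \<open>The point with homogeneous coordinates \<open>[a, b]\<close>. The value \<open>Infty\<close> for \<open>a = b = 0\<close> is junk.\<close>

definition quot :: "complex \<Rightarrow> complex \<Rightarrow> p1" where
  "quot a b = (if b = 0 then Infty else Aff (a / b))"

quotient_type plane = "complex^3" / partial:
  "\<lambda>u v. u \<noteq> 0 \<and> v \<noteq> 0 \<and> (\<exists>c. c \<noteq> 0 \<and> v = c *s u)"
proof (rule part_equivpI)
  show "\<exists>x::complex^3. x \<noteq> 0 \<and> x \<noteq> 0 \<and> (\<exists>c. c \<noteq> 0 \<and> x = c *s x)"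
    by (intro exI[of _ 1] conjI) (simp_all add: vec_eq_iff)
  show "symp (\<lambda>u v::complex^3. u \<noteq> 0 \<and> v \<noteq> 0 \<and> (\<exists>c. c \<noteq> 0 \<and> v = c *s u))"
  proof (rule sympI, elim conjE exE, intro conjI)
    fix u v :: "complex^3" and c :: complex
    assume "c \<noteq> 0" "v = c *s u"
    then show "\<exists>d. d \<noteq> 0 \<and> u = d *s v"
      by (intro exI[of _ "inverse c"]) (simp add: vector_smult_assoc)
  qed
  show "transp (\<lambda>u v::complex^3. u \<noteq> 0 \<and> v \<noteq> 0 \<and> (\<exists>c. c \<noteq> 0 \<and> v = c *s u))"
  proof (rule transpI, elim conjE exE, intro conjI)
    fix u v w :: "complex^3" and c d :: complex
    assume "c \<noteq> 0" "v = c *s u" "d \<noteq> 0" "w = d *s v"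
    then show "\<exists>e. e \<noteq> 0 \<and> w = e *s u"
      by (intro exI[of _ "d * c"]) (simp add: vector_smult_assoc)
  qed
qed

abbreviation pt :: "complex \<Rightarrow> complex \<Rightarrow> complex \<Rightarrow> plane" where
  "pt x y z \<equiv> abs_plane (vector [x, y, z])"

text \<open>Lines are points of the dual plane: \<open>[a, b, c]\<close> is the line \<open>a x + b y + c z = 0\<close>.\<close>

type_synonym line = plane

lift_definition incident :: "plane \<Rightarrow> line \<Rightarrow> bool"
  is "\<lambda>p l. scalar_product l p = 0"
proof -
  fix u v l m :: "complex^3"
  assume "u \<noteq> 0 \<and> v \<noteq> 0 \<and> (\<exists>c. c \<noteq> 0 \<and> v = c *s u)" "l \<noteq> 0 \<and> m \<noteq> 0 \<and> (\<exists>c. c \<noteq> 0 \<and> m = c *s l)"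
  then obtain c d where cd: "c \<noteq> 0" "v = c *s u" "d \<noteq> 0" "m = d *s l" by blast
  have "scalar_product m v = (d * c) * scalar_product l u"
    unfolding cd scalar_product_def by (simp add: sum_3 algebra_simps)
  then show "(scalar_product l u = 0) = (scalar_product m v = 0)"
    using cd by simp
qed

definition join :: "plane \<Rightarrow> plane \<Rightarrow> line" where
  "join P Q = (THE L. incident P L \<and> incident Q L)"


section \<open>The cross-ratio\<close>

text \<open>The determinant \<open>a d - b c\<close> of the homogeneous coordinates \<open>[a, b]\<close>, \<open>[c, d]\<close>, normalised to
  \<open>[x, 1]\<close> and \<open>[1, 0]\<close>; it extends the difference \<open>x - y\<close>.\<close>

fun bracket :: "p1 \<Rightarrow> p1 \<Rightarrow> complex" where
  "bracket (Aff x) (Aff y) = x - y"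
| "bracket Infty (Aff y) = 1"
| "bracket (Aff x) Infty = - 1"
| "bracket Infty Infty = 0"

definition cross_ratio :: "p1 \<Rightarrow> p1 \<Rightarrow> p1 \<Rightarrow> p1 \<Rightarrow> p1" where
  "cross_ratio x1 x2 x3 x4 =
     quot (bracket x1 x3 * bracket x2 x4) (bracket x2 x3 * bracket x1 x4)"

text \<open>A projective isomorphism from the pencil of lines through \<open>P\<close> to the projective line is
  induced by a linear isomorphism from the two-dimensional space of linear forms vanishing at \<open>P\<close>.\<close>

definition pencil_iso :: "plane \<Rightarrow> (line \<Rightarrow> p1) \<Rightarrow> bool" where
  "pencil_iso P \<phi> \<longleftrightarrow>
     (\<exists>F :: complex^3^2.
        bij_betw (\<lambda>l. F *v l) {l. scalar_product l (rep_plane P) = 0} UNIV \<and>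
        (\<forall>l. l \<noteq> 0 \<and> scalar_product l (rep_plane P) = 0 \<longrightarrow>
             \<phi> (abs_plane l) = quot ((F *v l) $ 1) ((F *v l) $ 2)))"

definition cross_ratio_lines :: "plane \<Rightarrow> line \<Rightarrow> line \<Rightarrow> line \<Rightarrow> line \<Rightarrow> p1" where
  "cross_ratio_lines P L1 L2 L3 L4 =
     (let \<phi> = (SOME \<phi>. pencil_iso P \<phi>) in cross_ratio (\<phi> L1) (\<phi> L2) (\<phi> L3) (\<phi> L4))"


section \<open>Conics\<close>

text \<open>A smooth conic is given by a nondegenerate symmetric matrix.\<close>

definition smooth_conic :: "complex^3^3 \<Rightarrow> bool" where
  "smooth_conic A \<longleftrightarrow> transpose A = A \<and> det A \<noteq> 0"

definition qform :: "complex^3^3 \<Rightarrow> complex^3 \<Rightarrow> complex" where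
  "qform A v = scalar_product v (A *v v)"

definition conic_points :: "complex^3^3 \<Rightarrow> plane set" where
  "conic_points A = {P. qform A (rep_plane P) = 0}"

definition tangent :: "complex^3^3 \<Rightarrow> plane \<Rightarrow> line" where
  "tangent A P = abs_plane (A *v rep_plane P)"

text \<open>The line \<open>PR\<close> for points \<open>P\<close>, \<open>R\<close> of the conic. For \<open>P = R\<close> it is the tangent, which is the
  limit of the chords \<open>XR\<close> as \<open>X\<close> tends to \<open>R\<close> along the conic.\<close>

definition chord :: "complex^3^3 \<Rightarrow> plane \<Rightarrow> plane \<Rightarrow> line" where
  "chord A P R = (if P = R then tangent A R else join P R)"

definition "R1 = pt 2 1 1"
definition "R2 = pt 12 16 1"
definition "R3 = pt 5 4 1"
definition "R4 = pt 8 16 1"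

definition has_value :: "complex^3^3 \<Rightarrow> complex \<Rightarrow> bool" where
  "has_value A q \<longleftrightarrow>
     (\<forall>P \<in> conic_points A.
        cross_ratio_lines P (chord A P R1) (chord A P R2) (chord A P R3) (chord A P R4) = Aff q)"

text \<open>Meaningful for \<open>q \<notin> {0, 1}\<close>. The matrix \<open>A\<close> is determined only up to a scalar factor.\<close>

definition pencil_conic :: "complex \<Rightarrow> plane set" where
  "pencil_conic q = (THE C. \<exists>A. smooth_conic A \<and> C = conic_points A \<and> {R1, R2, R3, R4} \<subseteq> C \<and> has_value A q)"


section \<open>Parametrisation\<close>

text \<open>The intersection multiplicity of the conic \<open>A\<close> and the line \<open>L\<close> at a point \<open>P\<close> of \<open>L\<close>: the
  order at \<open>s = 0\<close> of the polynomial \<open>qform A (p + s v)\<close> (here expanded, for symmetric \<open>A\<close>), where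
  \<open>s \<mapsto> p + s v\<close> parametrises \<open>L\<close> near \<open>P\<close>.\<close>

definition int_mult :: "complex^3^3 \<Rightarrow> line \<Rightarrow> plane \<Rightarrow> nat" where
  "int_mult A L P =
     (let p = rep_plane P;
          v = (SOME v. scalar_product (rep_plane L) v = 0 \<and> (\<forall>c. v \<noteq> c *s p))
      in order 0 [: qform A p, 2 * scalar_product p (A *v v), qform A v :])"

definition meet_in_pair :: "complex^3^3 \<Rightarrow> line \<Rightarrow> plane \<Rightarrow> plane \<Rightarrow> bool" where
  "meet_in_pair A L X Y \<longleftrightarrow>
     incident X L \<and> incident Y L \<and> (\<forall>Z. incident Z L \<longrightarrow> int_mult A L Z = count {#X, Y#} Z)"

fun line_R1 :: "p1 \<Rightarrow> line" where
  "line_R1 (Aff t) = pt t (- 1) (1 - 2 * t)"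
| "line_R1 Infty = pt 1 0 (- 2)"

definition conic_param :: "complex \<Rightarrow> p1 \<Rightarrow> plane" where
  "conic_param q t =
     (THE P. \<exists>A. smooth_conic A \<and> conic_points A = pencil_conic q \<and> meet_in_pair A (line_R1 t) R1 P)"


section \<open>The maps\<close>

definition pi_coords :: "complex^3 \<Rightarrow> complex^3" where
  "pi_coords p =
     (let x = p $ 1; y = p $ 2; z = p $ 3 in vector [2 * y * (y - x + 2 * z), y^2, (x - y)^2])"

definition tau_coords :: "complex^3 \<Rightarrow> complex^3" where
  "tau_coords p = (let x = p $ 1; y = p $ 2; z = p $ 3 in vector [2 * y - x, y, y - x + z])"

lemma pi_coords_smult: "pi_coords (c *s p) = c^2 *s pi_coords p"
  by (simp add: pi_coords_def Let_def vec_eq_iff forall_3 power2_eq_square algebra_simps)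

lemma tau_coords_smult: "tau_coords (c *s p) = c *s tau_coords p"
  by (simp add: tau_coords_def Let_def vec_eq_iff forall_3 algebra_simps)

lemma tau_coords_eq_0_iff: "tau_coords p = 0 \<longleftrightarrow> p = 0"
  by (auto simp: tau_coords_def Let_def vec_eq_iff forall_3)

text \<open>\<open>None\<close> marks the points of indeterminacy. The three components have no common factor, so
  these are exactly the points where all of them vanish.\<close>

lift_definition pi_map :: "plane \<Rightarrow> plane option"
  is "\<lambda>p. if pi_coords p = 0 then None else Some (pi_coords p)"
proof -
  fix u v :: "complex^3"
  assume "u \<noteq> 0 \<and> v \<noteq> 0 \<and> (\<exists>c. c \<noteq> 0 \<and> v = c *s u)"
  then obtain c where "c \<noteq> 0" "v = c *s u" by blast
  then have c: "c^2 \<noteq> 0" "pi_coords v = c^2 *s pi_coords u"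
    by (simp_all only: pi_coords_smult power_not_zero not_False_eq_True)
  show "rel_option (\<lambda>u v. u \<noteq> 0 \<and> v \<noteq> 0 \<and> (\<exists>c. c \<noteq> 0 \<and> v = c *s u))
     (if pi_coords u = 0 then None else Some (pi_coords u))
     (if pi_coords v = 0 then None else Some (pi_coords v))"
  proof (cases "pi_coords u = 0")
    case True
    then have "pi_coords v = 0" using c(2) by simp
    then show ?thesis using True by simp
  next
    case False
    then have "pi_coords v \<noteq> 0" using c by (simp only: vector_mul_eq_0 simp_thms)
    then show ?thesis using False c by (simp only: if_False option.rel_inject) blast
  qed
qed

text \<open>The map \<open>\<tau>\<close> is induced by an invertible matrix and so has no points of indeterminacy.\<close>

lift_definition tau_map :: "plane \<Rightarrow> plane" is tau_coords
proof -
  fix u v :: "complex^3"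
  assume uv: "u \<noteq> 0 \<and> v \<noteq> 0 \<and> (\<exists>c. c \<noteq> 0 \<and> v = c *s u)"
  then obtain c where "c \<noteq> 0" "v = c *s u" by blast
  then have "c \<noteq> 0 \<and> tau_coords v = c *s tau_coords u"
    by (simp add: tau_coords_smult)
  then show "tau_coords u \<noteq> 0 \<and> tau_coords v \<noteq> 0 \<and> (\<exists>c. c \<noteq> 0 \<and> tau_coords v = c *s tau_coords u)"
    using uv tau_coords_eq_0_iff by blast
qed

fun iota :: "p1 \<Rightarrow> p1" where
  "iota (Aff t) = quot (19 * t - 23) (16 * t - 19)"
| "iota Infty = quot 19 16"

fun beta :: "p1 \<Rightarrow> p1" where
  "beta (Aff t) = quot (44 * t^2 - 76 * t + 27) (56 * t^2 - 120 * t + 62)"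
| "beta Infty = quot 44 56"

end

theory Submission
  imports Defs
begin

text \<open>Lines \<open>l\<^sub>i\<close> through \<open>p\<close> satisfy \<open>l\<^sub>i \<times> l\<^sub>j = d\<^sub>i\<^sub>j p\<close>, and their cross-ratio is
  \<open>d\<^sub>1\<^sub>3 d\<^sub>2\<^sub>4 / d\<^sub>2\<^sub>3 d\<^sub>1\<^sub>4\<close>. So the value \<open>q\<close> imposes an explicit quadratic equation on \<open>P\<close>; conversely the
  value at \<open>P = R\<^sub>1\<close> fixes the tangent there, which together with the four base points determines the
  matrix up to a factor. With \<open>w\<close> the direction of a line through \<open>R\<^sub>1\<close> and \<open>B\<close> the bilinear form of the conic, the
  second intersection is \<open>- B(w,w) R\<^sub>1 + 2 B(R\<^sub>1,w) w\<close>. The equations for the two maps become polynomial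
  identities, and the equalities of sets follow as \<open>\<iota>\<close> and \<open>\<beta>\<close> are surjective.\<close>

section \<open>Coordinates, cross products and cross-ratios\<close>

definition cross :: "complex^3 \<Rightarrow> complex^3 \<Rightarrow> complex^3" where
  "cross u v = vector [u$2 * v$3 - u$3 * v$2, u$3 * v$1 - u$1 * v$3, u$1 * v$2 - u$2 * v$1]"

abbreviation bil :: "complex^3^3 \<Rightarrow> complex^3 \<Rightarrow> complex^3 \<Rightarrow> complex" where
  "bil A u v \<equiv> scalar_product u (A *v v)"

lemmas coords = scalar_product_def matrix_vector_mult_def sum_3 vec_eq_iff forall_3 cross_def

section \<open>Homogeneous coordinate vectors and the points they represent\<close>

lemma rep_plane_nonzero: "rep_plane P \<noteq> 0"
  using Quotient_rep_reflp[OF Quotient_plane, of P] by simp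

lemma abs_rep_plane [simp]: "abs_plane (rep_plane P) = P"
  using Quotient_abs_rep[OF Quotient_plane] by simp

lemma abs_plane_eq_iff:
  assumes "u \<noteq> 0" "v \<noteq> 0"
  shows "abs_plane u = abs_plane v \<longleftrightarrow> (\<exists>c. c \<noteq> 0 \<and> v = c *s u)"
proof -
  have refl: "x \<noteq> 0 \<Longrightarrow> \<exists>c. c \<noteq> 0 \<and> x = c *s x" for x :: "complex^3"
    by (intro exI[of _ 1]) simp
  show ?thesis
    using Quotient_rel[OF Quotient_plane, of u v] assms refl[of u] refl[of v] by metis
qed

lemma abs_plane_smult: "c \<noteq> 0 \<Longrightarrow> v \<noteq> 0 \<Longrightarrow> abs_plane (c *s v) = abs_plane v"
  by (subst eq_commute, subst abs_plane_eq_iff) auto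

lemma rep_abs_plane:
  assumes "v \<noteq> 0"
  obtains c where "c \<noteq> 0" "rep_plane (abs_plane v) = c *s v"
  using abs_plane_eq_iff[of v "rep_plane (abs_plane v)"] assms rep_plane_nonzero by auto

lemma plane_cases:
  obtains v where "v \<noteq> 0" "P = abs_plane v"
  using rep_plane_nonzero abs_rep_plane by metis

lemma incident_abs:
  assumes "u \<noteq> 0" "v \<noteq> 0"
  shows "incident (abs_plane u) (abs_plane v) \<longleftrightarrow> scalar_product v u = 0"
proof -
  have "x \<noteq> 0 \<Longrightarrow> \<exists>c. c \<noteq> 0 \<and> x = c *s x" for x :: "complex^3"
    by (intro exI[of _ 1]) simp
  with assms show ?thesis by (subst incident.abs_eq) (auto simp: eq_onp_def)
qed

section \<open>Cross products and the line through two points\<close>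

lemma vec3_nonzero: "vector [a, b, c] \<noteq> (0::complex^3) \<longleftrightarrow> a \<noteq> 0 \<or> b \<noteq> 0 \<or> c \<noteq> 0"
  by (auto simp: vec_eq_iff forall_3)

lemma cross_eq_0D:
  assumes "cross u v = 0" "v \<noteq> 0"
  obtains c where "u = c *s v"
proof -
  have e: "u$2 * v$3 = u$3 * v$2" "u$3 * v$1 = u$1 * v$3" "u$1 * v$2 = u$2 * v$1"
    using assms(1) by (simp_all add: coords)
  consider "v$1 \<noteq> 0" | "v$2 \<noteq> 0" | "v$3 \<noteq> 0" using assms(2) by (auto simp: vec_eq_iff forall_3)
  then show thesis
  proof cases
    case 1 then show ?thesis using e by (intro that[of "u$1/v$1"]) (simp add: vec_eq_iff forall_3 field_simps)
  next
    case 2 then show ?thesis using e by (intro that[of "u$2/v$2"]) (simp add: vec_eq_iff forall_3 field_simps)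
  next
    case 3 then show ?thesis using e by (intro that[of "u$3/v$3"]) (simp add: vec_eq_iff forall_3 field_simps)
  qed
qed

text \<open>Triple product expansion: a form vanishing at \<open>p\<close> and \<open>q\<close> has
  zero cross product with \<open>cross p q\<close>, hence is proportional to it. This makes the line
  in \<open>join\<close> unique.\<close>

lemma cross_cross: "cross l (cross p q) = scalar_product l q *s p - scalar_product l p *s q"
  by (simp add: coords algebra_simps)

lemma cross_eq_0_iff:
  assumes "u \<noteq> 0" "v \<noteq> 0"
  shows "cross u v = 0 \<longleftrightarrow> abs_plane u = abs_plane v"
proof
  assume "cross u v = 0"
  then obtain c where "u = c *s v" using assms cross_eq_0D by blast
  with assms show "abs_plane u = abs_plane v"
    by (metis abs_plane_smult vector_mul_eq_0)
next
  assume "abs_plane u = abs_plane v"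
  then obtain c where "v = c *s u" using abs_plane_eq_iff assms by blast
  then show "cross u v = 0" by (simp add: coords)
qed

lemma join_abs:
  assumes "p \<noteq> 0" "q \<noteq> 0" "abs_plane p \<noteq> abs_plane q"
  shows "join (abs_plane p) (abs_plane q) = abs_plane (cross p q)"
proof -
  have nz: "cross p q \<noteq> 0" using cross_eq_0_iff assms by blast
  show ?thesis unfolding join_def
  proof (rule the_equality)
    show "incident (abs_plane p) (abs_plane (cross p q)) \<and> incident (abs_plane q) (abs_plane (cross p q))"
      using assms nz by (simp add: incident_abs) (simp add: coords algebra_simps)
  next
    fix L assume L: "incident (abs_plane p) L \<and> incident (abs_plane q) L"
    obtain l where l: "l \<noteq> 0" "L = abs_plane l" by (rule plane_cases)
    then have "cross l (cross p q) = 0" using L assms by (simp add: incident_abs cross_cross)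
    then show "L = abs_plane (cross p q)" using l nz cross_eq_0_iff by blast
  qed
qed

section \<open>Cross-ratios of points of the projective line\<close>

lemma quot_scale: "k \<noteq> 0 \<Longrightarrow> quot (k * a) (k * b) = quot a b"
  by (simp add: quot_def)

lemma p1_cases:
  obtains a b where "(a, b) \<noteq> (0, 0)" "t = quot a b"
proof (cases t)
  case (Aff x) then show ?thesis by (intro that[of x 1]) (simp_all add: quot_def)
next
  case Infty then show ?thesis by (intro that[of 1 0]) (simp_all add: quot_def)
qed

text \<open>\<open>n a b\<close> is the factor between \<open>[a, b]\<close> and the normalised
  representative \<open>[x, 1]\<close> or \<open>[1, 0]\<close> from which \<open>bracket\<close> is
  formed.\<close>

lemma bracket_quot:
  obtains n where "\<And>a b. (a, b) \<noteq> (0, 0) \<Longrightarrow> n a b \<noteq> 0"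
    "\<And>a b c d. (a, b) \<noteq> (0, 0) \<Longrightarrow> (c, d) \<noteq> (0, 0) \<Longrightarrow>
       a * d - b * c = n a b * n c d * bracket (quot a b) (quot c d)"
proof (rule that[of "\<lambda>a b. if b = 0 then a else b"])
qed (auto simp: quot_def field_simps)

text \<open>Every index occurs once in the numerator and once in the denominator, so all normalising
  factors cancel, as does the common factor \<open>k\<close>.\<close>

lemma cross_ratio_quot:
  assumes nz: "\<And>i. i \<in> {1..4} \<Longrightarrow> (a i, b i) \<noteq> (0, 0)"
    and d: "\<And>i j. i \<in> {1..4} \<Longrightarrow> j \<in> {1..4} \<Longrightarrow> d i j = k * (a i * b j - b i * a j)" and k: "k \<noteq> 0"
  shows "cross_ratio (quot (a 1) (b 1)) (quot (a 2) (b 2)) (quot (a 3) (b 3)) (quot (a (4::nat)) (b 4))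
    = quot (d 1 3 * d 2 4) (d 2 3 * d 1 4)"
proof -
  obtain n where n: "\<And>a b. (a, b) \<noteq> (0, 0) \<Longrightarrow> n a b \<noteq> 0"
    "\<And>a b c d. (a, b) \<noteq> (0, 0) \<Longrightarrow> (c, d) \<noteq> (0, 0) \<Longrightarrow>
       a * d - b * c = n a b * n c d * bracket (quot a b) (quot c d)"
    using bracket_quot by blast
  define m where "m i = n (a i) (b i)" for i
  define x where "x i = quot (a i) (b i)" for i
  have m: "m 1 \<noteq> 0" "m 2 \<noteq> 0" "m 3 \<noteq> 0" "m 4 \<noteq> 0" using nz n(1) by (simp_all add: m_def)
  have e: "d i j = k * (m i * m j * bracket (x i) (x j))" if "i \<in> {1..4}" "j \<in> {1..4}" for i j
    using d[OF that] n(2) nz that by (simp add: m_def x_def)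
  have "d 1 3 * d 2 4 = (k^2 * m 1 * m 2 * m 3 * m 4) * (bracket (x 1) (x 3) * bracket (x 2) (x 4))"
    "d 2 3 * d 1 4 = (k^2 * m 1 * m 2 * m 3 * m 4) * (bracket (x 2) (x 3) * bracket (x 1) (x 4))"
    by (simp_all add: e power2_eq_square algebra_simps)
  then show ?thesis using m k
    by (simp add: cross_ratio_def quot_scale flip: x_def)
qed

section \<open>Pencils of lines and their cross-ratio\<close>

lemma pencil_iso_exists: "\<exists>\<phi>. pencil_iso P \<phi>"
proof -
  let ?p = "rep_plane P"
  let ?K = "{l. scalar_product l ?p = 0}"
  have "\<exists>F::complex^3^2. bij_betw (\<lambda>l. F *v l) ?K UNIV"
  proof -
    \<comment> \<open>Where a coordinate of the point is nonzero, a form vanishing at the point is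
      determined by its other two coefficients; projecting to these is the isomorphism.\<close>
    consider "?p$3 \<noteq> 0" | "?p$2 \<noteq> 0" | "?p$1 \<noteq> 0"
      using rep_plane_nonzero[of P] by (auto simp: vec_eq_iff forall_3)
    then show ?thesis
    proof cases
      case 1
      then show ?thesis
        by (intro exI[of _ "vector [vector [1,0,0], vector [0,1,0]]"]
          bij_betw_byWitness[where f' = "\<lambda>x. vector [x$1, x$2, - (x$1 * ?p$1 + x$2 * ?p$2) / ?p$3]"])
         (auto simp: coords forall_2 field_simps add_eq_0_iff)
    next
      case 2
      then show ?thesis
        by (intro exI[of _ "vector [vector [1,0,0], vector [0,0,1]]"]
          bij_betw_byWitness[where f' = "\<lambda>x. vector [x$1, - (x$1 * ?p$1 + x$2 * ?p$3) / ?p$2, x$2]"])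
         (auto simp: coords forall_2 field_simps add_eq_0_iff)
    next
      case 3
      then show ?thesis
        by (intro exI[of _ "vector [vector [0,1,0], vector [0,0,1]]"]
          bij_betw_byWitness[where f' = "\<lambda>x. vector [- (x$1 * ?p$2 + x$2 * ?p$3) / ?p$1, x$1, x$2]"])
         (auto simp: coords forall_2 field_simps add_eq_0_iff)
    qed
  qed
  then obtain F :: "complex^3^2" where F: "bij_betw (\<lambda>l. F *v l) ?K UNIV" by blast
  let ?\<phi> = "\<lambda>L. quot ((F *v rep_plane L) $ 1) ((F *v rep_plane L) $ 2)"
  have "?\<phi> (abs_plane l) = quot ((F *v l) $ 1) ((F *v l) $ 2)" if l: "l \<noteq> 0" for l
  proof -
    obtain c where c: "c \<noteq> 0" "rep_plane (abs_plane l) = c *s l" using rep_abs_plane[OF l] .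
    have "(F *v (c *s l)) $ i = c * (F *v l) $ i" for i
      by (simp add: coords algebra_simps)
    then show ?thesis using c by (simp add: quot_scale)
  qed
  then have "pencil_iso P ?\<phi>" unfolding pencil_iso_def using F by blast
  then show ?thesis by blast
qed

text \<open>Whichever isomorphism \<open>SOME\<close> picks, the determinants of the images of the
  forms are the \<open>d i j\<close> times one nonzero constant \<open>\<kappa>\<close>, which the
  cross-ratio ignores.\<close>

lemma cross_ratio_lines_eq:
  assumes p: "p \<noteq> 0"
    and l: "\<And>i. i \<in> {1..4} \<Longrightarrow> l i \<noteq> 0 \<and> scalar_product (l i) p = 0"
    and d: "\<And>i j. i \<in> {1..4} \<Longrightarrow> j \<in> {1..4} \<Longrightarrow> cross (l i) (l j) = d i j *s p"
  shows "cross_ratio_lines (abs_plane p) (abs_plane (l 1)) (abs_plane (l 2)) (abs_plane (l 3)) (abs_plane (l (4::nat)))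
    = quot (d 1 3 * d 2 4) (d 2 3 * d 1 4)"
proof -
  define \<phi> where "\<phi> = (SOME \<phi>. pencil_iso (abs_plane p) \<phi>)"
  obtain c where c: "c \<noteq> 0" "rep_plane (abs_plane p) = c *s p" using rep_abs_plane[OF p] .
  then have sc: "scalar_product m (rep_plane (abs_plane p)) = 0 \<longleftrightarrow> scalar_product m p = 0" for m
  proof -
    have "scalar_product m (c *s p) = c * scalar_product m p" by (simp add: coords algebra_simps)
    then show ?thesis using c by simp
  qed
  have "pencil_iso (abs_plane p) \<phi>" unfolding \<phi>_def using pencil_iso_exists by (rule someI_ex)
  then obtain F :: "complex^3^2" where
    F: "bij_betw (\<lambda>l. F *v l) {l. scalar_product l p = 0} UNIV"
    and \<phi>: "\<And>l. l \<noteq> 0 \<Longrightarrow> scalar_product l p = 0 \<Longrightarrow> \<phi> (abs_plane l) = quot ((F *v l) $ 1) ((F *v l) $ 2)"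
    unfolding pencil_iso_def sc by blast
  define \<kappa> where "\<kappa> = scalar_product (cross (F$1) (F$2)) p"
  have det: "(F *v l) $ 1 * (F *v m) $ 2 - (F *v l) $ 2 * (F *v m) $ 1 = \<kappa> * e"
    if "cross l m = e *s p" for l m e
  proof -
    \<comment> \<open>Binet-Cauchy identity for the two rows of \<open>F\<close>.\<close>
    have "(F *v l) $ 1 * (F *v m) $ 2 - (F *v l) $ 2 * (F *v m) $ 1 = scalar_product (cross (F$1) (F$2)) (cross l m)"
      by (simp add: coords algebra_simps)
    also have "\<dots> = \<kappa> * e" unfolding that \<kappa>_def by (simp add: coords algebra_simps)
    finally show ?thesis .
  qed
  have "\<kappa> \<noteq> 0"
  proof
    assume \<kappa>: "\<kappa> = 0"
    \<comment> \<open>Preimages of the unit vectors: their images have determinant 1, which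
      \<open>\<kappa> = 0\<close> forbids.\<close>
    obtain l m where lm: "scalar_product l p = 0" "F *v l = vector [1, 0]"
      "scalar_product m p = 0" "F *v m = vector [0, 1]"
      using F unfolding bij_betw_def by (metis (mono_tags, lifting) UNIV_I imageE mem_Collect_eq)
    have "cross (cross l m) p = scalar_product l p *s m - scalar_product m p *s l"
      by (simp add: coords algebra_simps)
    then have "cross (cross l m) p = 0" using lm by simp
    then obtain e where "cross l m = e *s p" using p cross_eq_0D by blast
    from det[OF this] lm \<kappa> show False by simp
  qed
  have inj: "(F *v m) $ 1 \<noteq> 0 \<or> (F *v m) $ 2 \<noteq> 0" if "m \<noteq> 0" "scalar_product m p = 0" for m
  proof (rule ccontr)
    assume "\<not> ?thesis"
    then have "F *v m = F *v 0" by (simp add: vec_eq_iff forall_2)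
    moreover have "scalar_product 0 p = 0" by (simp add: coords)
    ultimately show False using F that unfolding bij_betw_def inj_on_def by blast
  qed
  define a b where "a i = (F *v l i) $ 1" and "b i = (F *v l i) $ 2" for i
  have "\<phi> (abs_plane (l i)) = quot (a i) (b i)" if "i \<in> {1..4}" for i
    using \<phi> l[OF that] by (simp add: a_def b_def)
  moreover have "cross_ratio (quot (a 1) (b 1)) (quot (a 2) (b 2)) (quot (a 3) (b 3)) (quot (a 4) (b 4))
    = quot (d 1 3 * d 2 4) (d 2 3 * d 1 4)"
  proof (rule cross_ratio_quot[where k = "1/\<kappa>"])
    show "(a i, b i) \<noteq> (0, 0)" if "i \<in> {1..4}" for i
      using inj l[OF that] by (simp add: a_def b_def)
    show "d i j = 1 / \<kappa> * (a i * b j - b i * a j)" if "i \<in> {1..4}" "j \<in> {1..4}" for i j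
      using det[OF d[OF that]] \<open>\<kappa> \<noteq> 0\<close> by (simp add: a_def b_def)
    show "1 / \<kappa> \<noteq> 0" using \<open>\<kappa> \<noteq> 0\<close> by simp
  qed
  ultimately show ?thesis by (simp add: cross_ratio_lines_def flip: \<phi>_def)
qed

section \<open>Intersection of a conic and a line\<close>

lemma order_0_quadratic:
  fixes a b c :: complex
  assumes "a \<noteq> 0 \<or> b \<noteq> 0 \<or> c \<noteq> 0"
  shows "order 0 [:a, b, c:] = (if a \<noteq> 0 then 0 else if b \<noteq> 0 then 1 else 2)"
proof -
  have "order 0 [:0, b, c:] = 1" if "b \<noteq> 0"
  proof -
    have "[:0, b, c:] = monom 1 1 * [:b, c:]" by (simp add: monom_altdef)
    moreover have "monom 1 1 * [:b, c:] \<noteq> 0" using that by (intro no_zero_divisors) auto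
    moreover have "order 0 [:b, c:] = 0" using that by (intro order_0I) simp
    moreover have "order 0 (monom (1::complex) 1) = 1" by (rule order_0_monom) simp
    ultimately show ?thesis by (metis order_mult add_0_right)
  qed
  moreover have "order 0 [:0, 0, c:] = 2" if "c \<noteq> 0"
  proof -
    have "[:0, 0, c:] = monom c 2" by (simp add: monom_altdef numeral_2_eq_2)
    then show ?thesis using that by simp
  qed
  ultimately show ?thesis using assms by (auto simp: order_0I)
qed

section \<open>Bilinear forms and points of a conic\<close>

lemma bil_commute:
  assumes "transpose A = A"
  shows "bil A u v = bil A v u"
proof -
  have "A$1$2 = A$2$1" "A$1$3 = A$3$1" "A$2$3 = A$3$2"
    using assms by (simp_all add: vec_eq_iff transpose_def)
  then show ?thesis by (simp add: coords algebra_simps)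
qed

lemma bil_combination:
  assumes "transpose A = A"
  shows "bil A (a *s r + b *s w) (c *s r + d *s w) =
    a * c * bil A r r + (a * d + b * c) * bil A r w + b * d * bil A w w"
proof -
  have "A$1$2 = A$2$1" "A$1$3 = A$3$1" "A$2$3 = A$3$2"
    using assms by (simp_all add: vec_eq_iff transpose_def)
  then show ?thesis by (simp add: coords algebra_simps)
qed

lemma bil_smult: "bil A (a *s r) (b *s w) = a * b * bil A r w"
  by (simp add: coords algebra_simps)

lemma conic_points_abs:
  assumes "v \<noteq> 0"
  shows "abs_plane v \<in> conic_points A \<longleftrightarrow> bil A v v = 0"
proof -
  obtain c where "c \<noteq> 0" "rep_plane (abs_plane v) = c *s v" using rep_abs_plane[OF assms] .
  then show ?thesis by (simp add: conic_points_def qform_def bil_smult)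
qed

text \<open>The multiplicities fix the multiset on \<open>L\<close>, and it has no members off
  \<open>L\<close>. This serves the description operator in \<open>conic_param\<close>.\<close>

lemma meet_in_pair_unique:
  assumes "meet_in_pair A L X Y" "meet_in_pair A L X Y'"
  shows "Y = Y'"
proof -
  have "count {#X, Y#} Z = count {#X, Y'#} Z" for Z
  proof (cases "incident Z L")
    case True then show ?thesis using assms unfolding meet_in_pair_def by metis
  next
    case False
    then have "Z \<noteq> X" "Z \<noteq> Y" "Z \<noteq> Y'" using assms unfolding meet_in_pair_def by auto
    then show ?thesis by simp
  qed
  then have "{#X, Y#} = {#X, Y'#}" by (rule multiset_eqI)
  then show ?thesis by simp
qed

lemma on_line_combination:
  assumes "cross r w \<noteq> 0" "l \<noteq> 0" "scalar_product l r = 0" "scalar_product l w = 0" "scalar_product l z = 0"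
  obtains a b where "z = a *s r + b *s w"
proof -
  have "cross l (cross r w) = 0" using assms by (simp add: cross_cross)
  then obtain k where k: "l = k *s cross r w" using assms cross_eq_0D by blast
  with assms have "k \<noteq> 0" by auto
  have "scalar_product l z = k * scalar_product (cross r w) z"
    unfolding k by (simp add: coords algebra_simps)
  with assms \<open>k \<noteq> 0\<close> have z: "scalar_product (cross r w) z = 0" by simp
  let ?n = "cross r w"
  \<comment> \<open>Cramer's rule without division; the factor of the last term is the determinant
    of \<open>r\<close>, \<open>w\<close>, \<open>z\<close>, which is zero here.\<close>
  have id: "?n$i *s z = cross z w $ i *s r + cross r z $ i *s w + scalar_product ?n z *s axis i 1" for i
    unfolding cross_def using exhaust_3[of i]
    by (auto simp: vec_eq_iff forall_3 axis_def scalar_product_def sum_3 algebra_simps)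
  obtain i where i: "?n $ i \<noteq> 0" using assms(1) by (auto simp: vec_eq_iff)
  have "z = (1 / ?n$i) *s (?n$i *s z)" using i by (simp add: vector_smult_assoc)
  also have "\<dots> = (cross z w $ i / ?n$i) *s r + (cross r z $ i / ?n$i) *s w"
    by (simp add: id z vec_eq_iff field_simps add_divide_distrib)
  finally show thesis by (rule that)
qed

text \<open>At \<open>a *s r + b *s w\<close> the quadratic form is
  \<open>b * (2 * a * \<beta> + b * \<gamma>)\<close>: the first factor vanishes at
  \<open>r\<close>, the second at \<open>y\<close>. That \<open>\<beta>\<close> or
  \<open>\<gamma>\<close> is nonzero says that the conic does not contain the line.\<close>

lemma meet_in_pair_second_point:
  fixes A r w
  defines "\<beta> \<equiv> bil A r w" and "\<gamma> \<equiv> bil A w w"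
  defines "y \<equiv> (- \<gamma>) *s r + (2 * \<beta>) *s w"
  assumes A: "transpose A = A" and r: "bil A r r = 0" and nz: "\<beta> \<noteq> 0 \<or> \<gamma> \<noteq> 0"
    and rw: "cross r w \<noteq> 0" and l: "l \<noteq> 0" "scalar_product l r = 0" "scalar_product l w = 0"
  shows "y \<noteq> 0" "meet_in_pair A (abs_plane l) (abs_plane r) (abs_plane y)"
proof -
  have indep: "a = c \<and> b = d" if "a *s r + b *s w = c *s r + d *s w" for a b c d
  proof -
    have "cross (a *s r + b *s w) w = a *s cross r w" "cross r (a *s r + b *s w) = b *s cross r w" for a b
      by (simp_all add: coords algebra_simps)
    with that have "a *s cross r w = c *s cross r w" "b *s cross r w = d *s cross r w" by metis+
    then show ?thesis using rw by (simp add: vector_mul_rcancel)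
  qed
  have indep0: "a *s r + b *s w = 0 \<longleftrightarrow> a = 0 \<and> b = 0" for a b
    using indep[of a b 0 0] by auto
  have rne: "r \<noteq> 0" using rw by (auto simp: coords)
  show y0: "y \<noteq> 0" unfolding y_def indep0 using nz by auto
  let ?L = "abs_plane l"
  obtain k where k: "k \<noteq> 0" "rep_plane ?L = k *s l" using rep_abs_plane[OF l(1)] .
  have onL: "scalar_product (rep_plane ?L) v = 0 \<longleftrightarrow> scalar_product l v = 0" for v
  proof -
    have "scalar_product (k *s l) v = k * scalar_product l v" by (simp add: coords algebra_simps)
    then show ?thesis using k by simp
  qed
  have comb: "scalar_product l (a *s r + b *s w) = 0" for a b
  proof -
    have "scalar_product l (a *s r + b *s w) = a * scalar_product l r + b * scalar_product l w"
      by (simp add: coords algebra_simps)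
    then show ?thesis using l by simp
  qed
  have inc: "incident (abs_plane r) ?L" "incident (abs_plane y) ?L"
    using rne y0 l comb[of "- \<gamma>" "2 * \<beta>", folded y_def] by (simp_all add: incident_abs)
  have "int_mult A ?L Z = count {#abs_plane r, abs_plane y#} Z" if Z: "incident Z ?L" for Z
  proof -
    define z where "z = rep_plane Z"
    have z0: "z \<noteq> 0" and Zz: "Z = abs_plane z" using rep_plane_nonzero by (simp_all add: z_def)
    have "scalar_product l z = 0" using Z z0 l by (simp add: Zz incident_abs)
    then obtain a b where z: "z = a *s r + b *s w" using on_line_combination rw l by metis
    define v where "v = (SOME v. scalar_product (rep_plane ?L) v = 0 \<and> (\<forall>c. v \<noteq> c *s z))"
    \<comment> \<open>A direction as in \<open>int_mult\<close> exists: \<open>w\<close> if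
      \<open>z\<close> is a multiple of \<open>r\<close>, and \<open>r\<close> otherwise.\<close>
    have "\<exists>v. scalar_product (rep_plane ?L) v = 0 \<and> (\<forall>c. v \<noteq> c *s z)"
    proof (cases "b = 0")
      case True
      have "w \<noteq> c *s z" for c
        using indep[of 0 1 "c * a" "c * b"] True by (auto simp: z vector_add_ldistrib vector_smult_assoc)
      then show ?thesis using l onL by auto
    next
      case False
      have "r \<noteq> c *s z" for c
        using indep[of 1 0 "c * a" "c * b"] False by (auto simp: z vector_add_ldistrib vector_smult_assoc)
      then show ?thesis using l onL by auto
    qed
    then have "scalar_product (rep_plane ?L) v = 0 \<and> (\<forall>c. v \<noteq> c *s z)"
      unfolding v_def by (rule someI_ex)
    then have "scalar_product l v = 0" and vz: "\<And>c. v \<noteq> c *s z" using onL by auto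
    then obtain c d where v: "v = c *s r + d *s w" using on_line_combination rw l by metis
    have D: "a * d - b * c \<noteq> 0"
    proof
      assume D: "a * d - b * c = 0"
      show False
      proof (cases "a = 0")
        case True
        then have "b \<noteq> 0" "c = 0" using z0 z D by auto
        then show False using vz[of "d / b"] True by (auto simp: v z vector_smult_assoc)
      next
        case False
        then have "(c / a) * b = d" using D by (simp add: field_simps)
        then show False using vz[of "c / a"] False
          by (auto simp: v z vector_smult_assoc vector_add_ldistrib)
      qed
    qed
    have im: "int_mult A ?L Z = order 0 [: bil A z z, 2 * bil A z v, bil A v v :]"
      by (simp add: int_mult_def Let_def qform_def v_def z_def)
    have zz: "bil A z z = b * (2 * a * \<beta> + b * \<gamma>)"
      and zv: "bil A z v = (a * d + b * c) * \<beta> + b * d * \<gamma>"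
      and vv: "bil A v v = d * (2 * c * \<beta> + d * \<gamma>)"
      unfolding z v bil_combination[OF A] r \<beta>_def[symmetric] \<gamma>_def[symmetric] by (simp_all add: algebra_simps)
    have Zr: "abs_plane r = Z \<longleftrightarrow> b = 0"
    proof
      assume "abs_plane r = Z"
      then obtain e where "z = e *s r" using abs_plane_eq_iff rne z0 Zz by blast
      then show "b = 0" using indep[of a b e 0] z by auto
    next
      assume b: "b = 0"
      then have "z = a *s r" "a \<noteq> 0" using z z0 by auto
      then show "abs_plane r = Z" using rne Zz abs_plane_smult by auto
    qed
    have Zy: "abs_plane y = Z \<longleftrightarrow> 2 * a * \<beta> + b * \<gamma> = 0"
    proof
      assume "abs_plane y = Z"
      then obtain e where "z = e *s y" using abs_plane_eq_iff y0 z0 Zz by blast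
      then have "a = e * (- \<gamma>) \<and> b = e * (2 * \<beta>)"
        using indep[of a b "e * (- \<gamma>)" "e * (2 * \<beta>)"] z
        by (simp only: y_def vector_add_ldistrib vector_smult_assoc)
      then show "2 * a * \<beta> + b * \<gamma> = 0" by (simp add: algebra_simps)
    next
      assume e: "2 * a * \<beta> + b * \<gamma> = 0"
      have "cross z y = (2 * a * \<beta> + b * \<gamma>) *s cross r w"
        unfolding z y_def by (simp add: coords algebra_simps)
      then show "abs_plane y = Z" using e cross_eq_0_iff z0 y0 Zz by (metis vector_smult_lzero)
    qed
    show ?thesis
    proof (cases "b = 0")
      \<comment> \<open>At \<open>r\<close> the linear coefficient is
        \<open>a * d * \<beta>\<close>: the order is 1 if \<open>\<beta> \<noteq> 0\<close> and 2 if
        \<open>\<beta> = 0\<close>, which is when \<open>y\<close> represents the same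
        point.\<close>
      case b: True
      then have "a \<noteq> 0" "d \<noteq> 0" using D by auto
      then show ?thesis using b nz Zr Zy
        by (subst im, subst order_0_quadratic) (auto simp: zz zv vv)
    next
      case b: False
      show ?thesis
      proof (cases "2 * a * \<beta> + b * \<gamma> = 0")
        case True
        then have "\<beta> \<noteq> 0" using nz b by auto
        \<comment> \<open>At \<open>y\<close>, if it is another point than \<open>r\<close>, the
          last summand vanishes and the order is 1.\<close>
        have "bil A z v = (b * c - a * d) * \<beta> + d * (2 * a * \<beta> + b * \<gamma>)"
          unfolding zv by (simp add: algebra_simps)
        then have "bil A z v \<noteq> 0" using True \<open>\<beta> \<noteq> 0\<close> D by auto
        then show ?thesis using b True Zr Zy
          by (subst im, subst order_0_quadratic) (auto simp: zz)
      next
        case False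
        then show ?thesis using b Zr Zy
          by (subst im, subst order_0_quadratic) (auto simp: zz)
      qed
    qed
  qed
  then show "meet_in_pair A ?L (abs_plane r) (abs_plane y)"
    unfolding meet_in_pair_def using inc by blast
qed

section \<open>The conics of the pencil\<close>

definition base :: "nat \<Rightarrow> complex^3" where
  "base i = (if i = 1 then vector [2, 1, 1] else if i = 2 then vector [12, 16, 1]
     else if i = 3 then vector [5, 4, 1] else vector [8, 16, 1])"

lemma base_simps:
  "base 1 = vector [2, 1, 1]" "base (Suc 0) = vector [2, 1, 1]" "base 2 = vector [12, 16, 1]"
  "base 3 = vector [5, 4, 1]" "base 4 = vector [8, 16, 1]"
  by (simp_all add: base_def)

lemma R_base:
  "R1 = abs_plane (base 1)" "R2 = abs_plane (base 2)" "R3 = abs_plane (base 3)" "R4 = abs_plane (base 4)"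
  by (simp_all add: R1_def R2_def R3_def R4_def base_simps)

lemma index_cases:
  assumes "i \<in> {1..4::nat}"
  obtains "i = 1" | "i = 2" | "i = 3" | "i = 4"
  using assms by (auto simp: numeral_eq_Suc le_Suc_eq)

lemma base_nonzero: "base i \<noteq> 0"
  by (simp add: base_def vec3_nonzero)

lemma base_independent:
  assumes "i \<in> {1..4}" "j \<in> {1..4}" "i \<noteq> j"
  shows "cross (base i) (base j) \<noteq> 0"
  by (cases rule: index_cases[OF assms(1)]; cases rule: index_cases[OF assms(2)])
    (use assms(3) in \<open>simp_all add: cross_def vec3_nonzero base_simps\<close>)

lemma abs_base_inj:
  assumes "i \<in> {1..4}" "j \<in> {1..4}"
  shows "abs_plane (base i) = abs_plane (base j) \<longleftrightarrow> i = j"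
  using base_independent[OF assms] cross_eq_0_iff[OF base_nonzero base_nonzero] by blast

section \<open>Tangents and the cross-ratio of the four chords\<close>

lemma smooth_conic_ker:
  assumes "smooth_conic A" "v \<noteq> 0"
  shows "A *v v \<noteq> 0"
  using assms invertible_det_nz[of A] matrix_left_invertible_ker[of A]
  unfolding smooth_conic_def invertible_left_inverse by metis

lemma tangent_abs:
  assumes "smooth_conic A" "v \<noteq> 0"
  shows "tangent A (abs_plane v) = abs_plane (A *v v)"
proof -
  obtain c where c: "c \<noteq> 0" "rep_plane (abs_plane v) = c *s v" using rep_abs_plane[OF assms(2)] .
  have "A *v (c *s v) = c *s (A *v v)" by (simp add: coords algebra_simps)
  then show ?thesis using c smooth_conic_ker[OF assms] abs_plane_smult by (simp add: tangent_def)
qed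

text \<open>The cross product of the lines from \<open>p\<close> to two base points is
  \<open>p\<close> times the determinant of the three points.\<close>

lemma cross_ratio_chords_generic:
  fixes p defines "d \<equiv> \<lambda>i j. scalar_product p (cross (base i) (base j))"
  assumes p: "p \<noteq> 0" and ne: "\<And>i. i \<in> {1..4} \<Longrightarrow> abs_plane p \<noteq> abs_plane (base i)"
  shows "cross_ratio_lines (abs_plane p) (chord A (abs_plane p) R1) (chord A (abs_plane p) R2)
    (chord A (abs_plane p) R3) (chord A (abs_plane p) R4) = quot (d 1 3 * d 2 4) (d 2 3 * d 1 4)"
proof -
  have "chord A (abs_plane p) (abs_plane (base i)) = abs_plane (cross p (base i))" if "i \<in> {1..4}" for i
    using p ne[OF that] base_nonzero by (simp add: chord_def join_abs)
  moreover have "cross_ratio_lines (abs_plane p) (abs_plane (cross p (base 1))) (abs_plane (cross p (base 2)))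
    (abs_plane (cross p (base 3))) (abs_plane (cross p (base 4))) = quot (d 1 3 * d 2 4) (d 2 3 * d 1 4)"
  proof (rule cross_ratio_lines_eq[OF p])
    show "cross p (base i) \<noteq> 0 \<and> scalar_product (cross p (base i)) p = 0" if "i \<in> {1..4}" for i
      using cross_eq_0_iff[OF p base_nonzero] ne[OF that] by (simp add: coords algebra_simps)
    show "cross (cross p (base i)) (cross p (base j)) = d i j *s p" for i j
      unfolding d_def by (simp add: coords algebra_simps)
  qed
  ultimately show ?thesis by (simp add: R_base)
qed

text \<open>At a base point the tangent replaces one chord. Since \<open>base k\<close> is on the
  conic, the triple product expansion of \<open>cross (A *v base k) (cross (base k) v)\<close>
  leaves \<open>bil A (base k) v *s base k\<close>, so determinants with index \<open>k\<close>
  become values of the bilinear form.\<close>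

lemma cross_ratio_chords_base:
  fixes A k
  defines "d \<equiv> \<lambda>i j. if i = k then (if j = k then 0 else bil A (base k) (base j))
      else if j = k then - bil A (base k) (base i) else scalar_product (base k) (cross (base i) (base j))"
  assumes A: "smooth_conic A" and k: "k \<in> {1..4}" and on: "bil A (base k) (base k) = 0"
  shows "cross_ratio_lines (abs_plane (base k)) (chord A (abs_plane (base k)) R1) (chord A (abs_plane (base k)) R2)
    (chord A (abs_plane (base k)) R3) (chord A (abs_plane (base k)) R4) = quot (d 1 3 * d 2 4) (d 2 3 * d 1 4)"
proof -
  define l where "l i = (if i = k then A *v base k else cross (base k) (base i))" for i
  have "chord A (abs_plane (base k)) (abs_plane (base i)) = abs_plane (l i)" if "i \<in> {1..4}" for i
    using base_nonzero A abs_base_inj[OF k that] by (simp add: chord_def join_abs tangent_abs l_def)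
  moreover have "cross_ratio_lines (abs_plane (base k)) (abs_plane (l 1)) (abs_plane (l 2))
    (abs_plane (l 3)) (abs_plane (l 4)) = quot (d 1 3 * d 2 4) (d 2 3 * d 1 4)"
  proof (rule cross_ratio_lines_eq[OF base_nonzero])
    have comm: "scalar_product (A *v v) u = bil A u v" for u v
      by (simp add: scalar_product_def mult.commute)
    show "l i \<noteq> 0 \<and> scalar_product (l i) (base k) = 0" if "i \<in> {1..4}" for i
    proof (cases "i = k")
      case True
      then show ?thesis using smooth_conic_ker[OF A base_nonzero] on by (simp add: l_def comm)
    next
      case False
      then show ?thesis using base_independent[OF k that]
        by (simp add: l_def) (simp add: coords algebra_simps)
    qed
    have sym: "transpose A = A" using A by (simp add: smooth_conic_def)
    have anti: "cross u v = - cross v u" for u v by (simp add: coords)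
    have T: "cross (A *v base k) (cross (base k) v) = bil A (base k) v *s base k" for v
      using on by (simp add: cross_cross comm bil_commute[OF sym, of v])
    have G: "cross (cross p u) (cross p v) = scalar_product p (cross u v) *s p" for p u v
      by (simp add: coords algebra_simps)
    have S: "cross v v = 0" for v by (simp add: coords)
    show "cross (l i) (l j) = d i j *s base k" for i j
      by (auto simp: l_def d_def S T G anti[of "cross _ _" "A *v _"] vector_smult_lneg)
  qed
  ultimately show ?thesis by (simp add: R_base)
qed

text \<open>Two thirds of the symmetric matrix of \<open>[P13][P24] - q [P23][P14]\<close>, where \<open>[Pij]\<close> is the
  determinant of the coordinates of \<open>P\<close>, \<open>R\<^sub>i\<close> and \<open>R\<^sub>j\<close>.\<close>

definition cmat :: "complex \<Rightarrow> complex^3^3" where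
  "cmat q = vector [vector [120 * q, 4 - 59 * q, - 64 - 256 * q],
     vector [4 - 59 * q, 28 * q - 8, 60 + 120 * q],
     vector [- 64 - 256 * q, 60 + 120 * q, 128 + 512 * q]]"

section \<open>The member of the pencil with value q\<close>

lemma transpose_cmat: "transpose (cmat q) = cmat q"
  by (simp add: cmat_def transpose_def vec_eq_iff forall_3)

text \<open>The zeros of the determinant are the line pairs of the pencil: R1R3 and R2R4 for
  \<open>q = 0\<close>, R1R2 and R3R4 for \<open>q = 1\<close>.\<close>

lemma smooth_cmat:
  assumes "q \<noteq> 0" "q \<noteq> 1"
  shows "smooth_conic (cmat q)"
proof -
  have "det (cmat q) = 86400 * q * (q - 1)"
    by (simp add: cmat_def det_3 algebra_simps)
  then show ?thesis using assms transpose_cmat by (simp add: smooth_conic_def)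
qed

lemma bil_cmat:
  "3 * bil (cmat q) p p = 2 * (scalar_product p (cross (base 1) (base 3)) * scalar_product p (cross (base 2) (base 4))
    - q * (scalar_product p (cross (base 2) (base 3)) * scalar_product p (cross (base 1) (base 4))))"
  by (simp add: cmat_def base_simps coords algebra_simps)

lemma base_on_cmat: "i \<in> {1..4} \<Longrightarrow> bil (cmat q) (base i) (base i) = 0"
  by (erule index_cases) (simp_all add: cmat_def base_simps coords algebra_simps)

text \<open>At a base point the value comes from explicit numbers. Elsewhere the equation of the
  conic makes the numerator \<open>q\<close> times the denominator, and the point is that the
  denominator is nonzero.\<close>

lemma has_value_cmat:
  assumes q: "q \<noteq> 0" "q \<noteq> 1"
  shows "has_value (cmat q) q"
  unfolding has_value_def
proof
  fix P assume P: "P \<in> conic_points (cmat q)"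
  obtain p where p: "p \<noteq> 0" "P = abs_plane p" by (rule plane_cases)
  show "cross_ratio_lines P (chord (cmat q) P R1) (chord (cmat q) P R2) (chord (cmat q) P R3) (chord (cmat q) P R4) = Aff q"
  proof (cases "\<exists>k\<in>{1..4}. P = abs_plane (base k)")
    case True
    then obtain k where k: "k \<in> {1..4}" "P = abs_plane (base k)" by blast
    note cr = cross_ratio_chords_base[OF smooth_cmat[OF q] k(1) base_on_cmat[OF k(1)]]
    show ?thesis unfolding k(2) cr
      by (cases rule: index_cases[OF k(1)])
        (use q in \<open>simp_all add: cmat_def base_simps coords quot_def field_simps\<close>)
  next
    case False
    define d where "d i j = scalar_product p (cross (base i) (base j))" for i j
    have ne: "cross p (base i) \<noteq> 0" if "i \<in> {1..4}" for i
      using False that cross_eq_0_iff[OF p(1) base_nonzero] p(2) by blast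
    have e: "d 1 3 * d 2 4 = q * (d 2 3 * d 1 4)"
      using P bil_cmat[of p q] p by (simp add: conic_points_abs d_def)
    \<comment> \<open>Two distinct lines through a base point meet only there, so P is not on
      both.\<close>
    have ni: "\<not> (d i j = 0 \<and> d i k = 0)"
      if "i \<in> {1..4}" "scalar_product (base i) (cross (base j) (base k)) \<noteq> 0" for i j k
    proof -
      have "scalar_product (base i) (cross (base j) (base k)) *s cross p (base i)
        = d i k *s cross (base i) (base j) - d i j *s cross (base i) (base k)"
        unfolding d_def by (simp add: coords algebra_simps)
      then show ?thesis using that ne by (metis diff_self vector_mul_eq_0 vector_smult_lzero)
    qed
    have anti: "d i j = 0 \<longleftrightarrow> d j i = 0" for i j
    proof -
      have "d i j = - d j i" unfolding d_def by (simp add: coords algebra_simps)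
      then show ?thesis by simp
    qed
    \<comment> \<open>A zero denominator forces a zero numerator, putting P on R1R3 or R2R4 and on
      R2R3 or R1R4. The four combinations meet in R3, R2, R1, R4, in the order treated here.\<close>
    have "\<not> (d 3 2 = 0 \<and> d 3 1 = 0)" by (rule ni) (simp_all add: base_simps coords)
    moreover have "\<not> (d 2 3 = 0 \<and> d 2 4 = 0)" by (rule ni) (simp_all add: base_simps coords)
    moreover have "\<not> (d 1 4 = 0 \<and> d 1 3 = 0)" by (rule ni) (simp_all add: base_simps coords)
    moreover have "\<not> (d 4 1 = 0 \<and> d 4 2 = 0)" by (rule ni) (simp_all add: base_simps coords)
    ultimately have "d 2 3 * d 1 4 \<noteq> 0"
      using e q anti[of 3 2] anti[of 3 1] anti[of 4 1] anti[of 4 2] by auto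
    moreover have "cross_ratio_lines P (chord (cmat q) P R1) (chord (cmat q) P R2)
      (chord (cmat q) P R3) (chord (cmat q) P R4) = quot (d 1 3 * d 2 4) (d 2 3 * d 1 4)"
      unfolding p(2) d_def by (rule cross_ratio_chords_generic) (use p False in auto)
    ultimately show ?thesis using e by (simp add: quot_def)
  qed
qed

text \<open>The direction of the line through \<open>R\<^sub>1\<close> tangent to the conic with value \<open>q\<close>.\<close>

abbreviation tdir :: "complex \<Rightarrow> complex^3" where
  "tdir q \<equiv> vector [2 * q + 4, 5 * q + 4, 0]"

text \<open>The base points leave two of the six entries of a symmetric matrix free; the tangent at
  R1 fixes their ratio.\<close>

lemma conic_through_base:
  assumes A: "smooth_conic A" and on: "\<And>i. i \<in> {1..4} \<Longrightarrow> bil A (base i) (base i) = 0"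
    and tan: "bil A (base 1) (tdir q) = 0" and q: "q \<noteq> 0"
  obtains \<alpha> where "\<alpha> \<noteq> 0" "\<And>u v. bil A u v = \<alpha> * bil (cmat q) u v"
proof -
  have sym: "A$2$1 = A$1$2" "A$3$1 = A$1$3" "A$3$2 = A$2$3"
    using A by (simp_all add: smooth_conic_def vec_eq_iff transpose_def)
  \<comment> \<open>\<open>\<alpha>\<close> is to multiply the constant part of \<open>cmat\<close>
    and \<open>\<beta>\<close> the part linear in \<open>q\<close>; both are read off from the first
    two entries, \<open>120 * q\<close> and \<open>4 - 59 * q\<close>.\<close>
  define \<beta> \<alpha> where "\<beta> = A$1$1 / 120" and "\<alpha> = (A$1$2 + 59 * \<beta>) / 4"
  have 11: "A$1$1 = 120 * \<beta>" and 12: "A$1$2 = 4 * \<alpha> - 59 * \<beta>" by (simp_all add: \<alpha>_def \<beta>_def field_simps)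
  note eqs = on[of 1] on[of 2] on[of 3] on[of 4]
  have e: "A$2$2 = 28 * \<beta> - 8 * \<alpha> \<and> A$1$3 = - 64 * \<alpha> - 256 * \<beta> \<and> A$2$3 = 60 * \<alpha> + 120 * \<beta> \<and> A$3$3 = 128 * \<alpha> + 512 * \<beta>"
    using eqs by (simp add: base_simps coords sym 11 12) algebra
  have "q * (q * \<alpha> - \<beta>) = 0"
    using tan by (simp add: base_simps coords sym 11 12 e) algebra
  then have \<beta>: "\<beta> = q * \<alpha>" using q by auto
  have entries: "A = (\<chi> i j. \<alpha> * cmat q $ i $ j)"
    by (simp add: vec_eq_iff forall_3 cmat_def sym 11 12 e \<beta> algebra_simps)
  have "det A \<noteq> 0" using A by (simp add: smooth_conic_def)
  then have "\<alpha> \<noteq> 0" unfolding entries by (auto simp: det_3)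
  moreover have "bil A u v = \<alpha> * bil (cmat q) u v" for u v
    unfolding entries by (simp add: coords algebra_simps)
  ultimately show thesis by (rule that)
qed

section \<open>The parametrisation\<close>

lemma conic_points_bil_cong:
  assumes "\<alpha> \<noteq> 0" "\<And>u v. bil A u v = \<alpha> * bil B u v"
  shows "conic_points A = conic_points B"
  using assms by (simp add: conic_points_def qform_def)

lemma base_in_conic_points:
  assumes "{R1, R2, R3, R4} \<subseteq> conic_points A" "i \<in> {1..4}"
  shows "bil A (base i) (base i) = 0"
  by (cases rule: index_cases[OF assms(2)])
    (use assms(1) in \<open>simp_all add: R_base conic_points_abs base_nonzero\<close>)

lemma quot_eq_Aff: "quot a b = Aff q \<Longrightarrow> a = q * b"
  by (auto simp: quot_def split: if_splits)

text \<open>At \<open>P = R1\<close> the tangent is one of the four lines, so the value there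
  determines its direction.\<close>

lemma has_value_tangent:
  assumes A: "smooth_conic A" and on: "{R1, R2, R3, R4} \<subseteq> conic_points A" and hv: "has_value A q"
  shows "bil A (base 1) (tdir q) = 0"
proof -
  have 1: "bil A (base 1) (base 1) = 0" by (rule base_in_conic_points[OF on]) simp
  have "abs_plane (base 1) \<in> conic_points A" using 1 base_nonzero by (simp add: conic_points_abs)
  then have "cross_ratio_lines (abs_plane (base 1)) (chord A (abs_plane (base 1)) R1)
      (chord A (abs_plane (base 1)) R2) (chord A (abs_plane (base 1)) R3)
      (chord A (abs_plane (base 1)) R4) = Aff q"
    using hv unfolding has_value_def by blast
  moreover have "scalar_product (base 1) (cross (base 2) (base 4)) = 60"
    "scalar_product (base 1) (cross (base 2) (base 3)) = - 15"
    by (simp_all add: base_simps coords)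
  ultimately have "quot (bil A (base 1) (base 3) * 60) (- 15 * bil A (base 1) (base 4)) = Aff q"
    using cross_ratio_chords_base[OF A _ 1] by (simp del: One_nat_def)
  from quot_eq_Aff[OF this] have "4 * bil A (base 1) (base 3) = - (q * bil A (base 1) (base 4))"
    by algebra
  \<comment> \<open>By linearity from the identity of vectors
    \<open>3 tdir q + (4 + q) base 1 = 4 base 3 + q base 4\<close>.\<close>
  moreover have "3 * bil A (base 1) (tdir q) + (4 + q) * bil A (base 1) (base 1) =
    4 * bil A (base 1) (base 3) + q * bil A (base 1) (base 4)"
    by (simp add: base_simps coords algebra_simps)
  ultimately show ?thesis using 1 by simp
qed

theorem pencil_conic_eq:
  assumes q: "q \<noteq> 0" "q \<noteq> 1"
  shows "pencil_conic q = conic_points (cmat q)"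
  unfolding pencil_conic_def
proof (rule the_equality)
  have "{R1, R2, R3, R4} \<subseteq> conic_points (cmat q)"
    by (simp add: R_base conic_points_abs base_nonzero base_on_cmat)
  then show "\<exists>A. smooth_conic A \<and> conic_points (cmat q) = conic_points A \<and>
      {R1, R2, R3, R4} \<subseteq> conic_points (cmat q) \<and> has_value A q"
    using smooth_cmat[OF q] has_value_cmat[OF q] by blast
next
  fix C assume "\<exists>A. smooth_conic A \<and> C = conic_points A \<and> {R1, R2, R3, R4} \<subseteq> C \<and> has_value A q"
  then obtain A where A: "smooth_conic A" "C = conic_points A" "{R1, R2, R3, R4} \<subseteq> conic_points A" "has_value A q"
    by blast
  obtain \<alpha> where "\<alpha> \<noteq> 0" "\<And>u v. bil A u v = \<alpha> * bil (cmat q) u v"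
    using conic_through_base[OF A(1) base_in_conic_points[OF A(3)] has_value_tangent[OF A(1,3,4)] q(1)] by metis
  then show "C = conic_points (cmat q)" unfolding A(2) by (rule conic_points_bil_cong)
qed

section \<open>The second intersection with a line through R1\<close>

definition beta_form :: "complex \<Rightarrow> complex \<Rightarrow> complex \<Rightarrow> complex" where
  "beta_form q t s = 15 * ((2 * q + 4) * t - (5 * q + 4) * s)"

definition gamma_form :: "complex \<Rightarrow> complex \<Rightarrow> complex \<Rightarrow> complex" where
  "gamma_form q t s = (28 * q - 8) * t^2 + (8 - 118 * q) * t * s + 120 * q * s^2"

text \<open>The line with parameter \<open>[t, s]\<close> has slope \<open>t / s\<close>, so it
  joins R1 to the point \<open>[s, t, 0]\<close>; the two forms describe the conic restricted to
  it.\<close>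

lemma bil_dir:
  "bil (cmat q) (base 1) (vector [s, t, 0]) = beta_form q t s"
  "bil (cmat q) (vector [s, t, 0]) (vector [s, t, 0]) = gamma_form q t s"
  by (simp_all add: beta_form_def gamma_form_def cmat_def base_simps coords algebra_simps power2_eq_square)


text \<open>Otherwise the smooth conic would contain a line. Algebraically, elimination leaves
  \<open>384 * q * (1 - q)\<close> times \<open>s^2\<close> or \<open>t^2\<close>.\<close>

lemma forms_nonzero:
  assumes q: "q \<noteq> 0" "q \<noteq> 1" and ts: "(t, s) \<noteq> (0, 0)"
  shows "beta_form q t s \<noteq> 0 \<or> gamma_form q t s \<noteq> 0"
proof (rule ccontr)
  assume "\<not> ?thesis"
  then have e: "(2 * q + 4) * t = (5 * q + 4) * s" and g: "gamma_form q t s = 0"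
    by (simp_all add: beta_form_def)
  \<comment> \<open>Either of \<open>2 * q + 4\<close> and \<open>5 * q + 4\<close> may vanish, so
    the form is multiplied by their squares instead of dividing.\<close>
  have "(2 * q + 4)^2 * gamma_form q t s = (28 * q - 8) * ((2 * q + 4) * t)^2
      + (8 - 118 * q) * ((2 * q + 4) * t) * ((2 * q + 4) * s) + 120 * q * ((2 * q + 4) * s)^2"
    by (simp add: gamma_form_def power2_eq_square algebra_simps)
  also have "\<dots> = 384 * q * (1 - q) * s^2"
    unfolding e by (simp add: power2_eq_square algebra_simps)
  finally have s: "s = 0" using g q by simp
  have "(5 * q + 4)^2 * gamma_form q t s = (28 * q - 8) * ((5 * q + 4) * t)^2
      + (8 - 118 * q) * ((5 * q + 4) * t) * ((5 * q + 4) * s) + 120 * q * ((5 * q + 4) * s)^2"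
    by (simp add: gamma_form_def power2_eq_square algebra_simps)
  also have "\<dots> = 384 * q * (1 - q) * t^2"
    unfolding e[symmetric] by (simp add: power2_eq_square algebra_simps)
  finally have "t = 0" using g q by simp
  with s ts show False by simp
qed

definition ypt :: "complex \<Rightarrow> complex \<Rightarrow> complex \<Rightarrow> complex^3" where
  "ypt q t s = (- gamma_form q t s) *s base 1 + (2 * beta_form q t s) *s vector [s, t, 0]"

lemma tdir_nonzero: "(5 * q + 4, 2 * q + 4) \<noteq> (0, 0 :: complex)"
proof
  assume "(5 * q + 4, 2 * q + 4) = (0, 0)"
  then have e: "5 * q + 4 = 0" "2 * q + 4 = 0" by auto
  have "12 = 5 * (2 * q + 4) - 2 * (5 * q + 4)" by (simp add: algebra_simps)
  also have "\<dots> = 0" unfolding e by simp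
  finally show False by simp
qed

text \<open>\<open>conic_param\<close> admits every matrix with the right point set. If its tangent
  at R1 were not that of \<open>cmat q\<close>, the latter line would meet its conic in a second
  point \<open>y\<close>, which is not on the conic of \<open>cmat q\<close>.\<close>

lemma conic_points_determine_matrix:
  assumes q: "q \<noteq> 0" "q \<noteq> 1" and A: "smooth_conic A" and eq: "conic_points A = conic_points (cmat q)"
  obtains \<alpha> where "\<alpha> \<noteq> 0" "\<And>u v. bil A u v = \<alpha> * bil (cmat q) u v"
proof -
  have sym: "transpose A = A" using A by (simp add: smooth_conic_def)
  have iff: "v \<noteq> 0 \<Longrightarrow> bil A v v = 0 \<longleftrightarrow> bil (cmat q) v v = 0" for v
    using conic_points_abs[of v] eq by metis
  have on: "bil A (base i) (base i) = 0" if "i \<in> {1..4}" for i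
    using iff[OF base_nonzero] base_on_cmat that by blast
  have b0: "beta_form q (5 * q + 4) (2 * q + 4) = 0" by (simp add: beta_form_def algebra_simps)
  have tan: "bil A (base 1) (tdir q) = 0"
  proof (rule ccontr)
    let ?\<beta> = "bil A (base 1) (tdir q)" and ?\<gamma> = "bil A (tdir q) (tdir q)"
    assume nz: "?\<beta> \<noteq> 0"
    define y where "y = (- ?\<gamma>) *s base 1 + (2 * ?\<beta>) *s tdir q"
    have yA: "bil A y y = 0"
      unfolding y_def bil_combination[OF sym] using on[of 1] by (simp add: algebra_simps)
    have yM: "bil (cmat q) y y = (2 * ?\<beta>)^2 * gamma_form q (5 * q + 4) (2 * q + 4)"
      unfolding y_def bil_combination[OF transpose_cmat] bil_dir b0
      using base_on_cmat[of 1] by (simp add: power2_eq_square)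
    have "gamma_form q (5 * q + 4) (2 * q + 4) \<noteq> 0" using forms_nonzero[OF q tdir_nonzero] b0 by simp
    then have yMnz: "bil (cmat q) y y \<noteq> 0" using nz yM by simp
    then have "y \<noteq> 0" by (auto simp: coords)
    with iff yA yMnz show False by blast
  qed
  show thesis using conic_through_base[OF A on tan q(1)] that by metis
qed

section \<open>The parametrisation and its image\<close>

lemma line_R1_quot:
  assumes "(t, s) \<noteq> (0, 0)"
  shows "line_R1 (quot t s) = pt t (- s) (s - 2 * t)"
proof (cases "s = 0")
  case True
  then have "vector [t, - s, s - 2 * t] = t *s (vector [1, 0, -2] :: complex^3)"
    by (simp add: vec_eq_iff forall_3)
  then show ?thesis using True assms by (simp add: quot_def abs_plane_smult vec3_nonzero)
next
  case False
  then have "vector [t, - s, s - 2 * t] = s *s (vector [t / s, -1, 1 - 2 * (t / s)] :: complex^3)"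
    by (simp add: vec_eq_iff forall_3 field_simps)
  then show ?thesis using False by (simp add: quot_def abs_plane_smult vec3_nonzero)
qed

lemma cross_base_dir: "(t, s) \<noteq> (0, 0) \<Longrightarrow> cross (base 1) (vector [s, t, 0]) \<noteq> 0"
  by (auto simp: cross_def vec3_nonzero base_simps)

text \<open>Every admissible matrix is a multiple of \<open>cmat q\<close>, and this only rescales
  the coordinates of the second intersection.\<close>

lemma
  assumes q: "q \<noteq> 0" "q \<noteq> 1" and ts: "(t, s) \<noteq> (0, 0)"
  shows ypt_nonzero: "ypt q t s \<noteq> 0"
    and conic_param_quot: "conic_param q (quot t s) = abs_plane (ypt q t s)"
proof -
  let ?w = "vector [s, t, 0] :: complex^3" and ?l = "vector [t, - s, s - 2 * t] :: complex^3"
  have l: "?l \<noteq> 0" "scalar_product ?l (base 1) = 0" "scalar_product ?l ?w = 0"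
    using ts by (auto simp: vec3_nonzero base_simps coords)
  have R: "R1 = abs_plane (base 1)" by (rule R_base)
  have second: "ypt q t s \<noteq> 0 \<and> meet_in_pair A (line_R1 (quot t s)) R1 (abs_plane (ypt q t s))"
    if A: "transpose A = A" and \<alpha>: "\<alpha> \<noteq> 0" "\<And>u v. bil A u v = \<alpha> * bil (cmat q) u v" for A \<alpha>
  proof -
    have f: "bil A (base 1) (base 1) = 0" "bil A (base 1) ?w = \<alpha> * beta_form q t s"
      "bil A ?w ?w = \<alpha> * gamma_form q t s"
      unfolding \<alpha>(2) bil_dir using base_on_cmat[of 1] by simp_all
    let ?y = "(- bil A ?w ?w) *s base 1 + (2 * bil A (base 1) ?w) *s ?w"
    have y: "?y = \<alpha> *s ypt q t s"
      unfolding f ypt_def vector_add_ldistrib vector_smult_assoc by (simp add: algebra_simps)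
    have "bil A (base 1) ?w \<noteq> 0 \<or> bil A ?w ?w \<noteq> 0"
      unfolding f using \<alpha>(1) forms_nonzero[OF q ts] by simp
    note m = meet_in_pair_second_point[OF A f(1) this cross_base_dir[OF ts] l]
    have nz: "ypt q t s \<noteq> 0" using m(1) unfolding y by auto
    then show ?thesis using m(2) unfolding y abs_plane_smult[OF \<alpha>(1) nz] line_R1_quot[OF ts] R by blast
  qed
  note M = second[OF transpose_cmat, of 1]
  show "ypt q t s \<noteq> 0" using M by simp
  show "conic_param q (quot t s) = abs_plane (ypt q t s)"
    unfolding conic_param_def pencil_conic_eq[OF q]
  proof (rule the_equality)
    show "\<exists>A. smooth_conic A \<and> conic_points A = conic_points (cmat q) \<and>
        meet_in_pair A (line_R1 (quot t s)) R1 (abs_plane (ypt q t s))"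
      using M smooth_cmat[OF q] by auto
  next
    fix P assume "\<exists>A. smooth_conic A \<and> conic_points A = conic_points (cmat q) \<and>
        meet_in_pair A (line_R1 (quot t s)) R1 P"
    then obtain A where A: "smooth_conic A" "conic_points A = conic_points (cmat q)"
      "meet_in_pair A (line_R1 (quot t s)) R1 P" by blast
    obtain \<alpha> where "\<alpha> \<noteq> 0" "\<And>u v. bil A u v = \<alpha> * bil (cmat q) u v"
      using conic_points_determine_matrix[OF q A(1,2)] by blast
    then show "P = abs_plane (ypt q t s)"
      using meet_in_pair_unique[OF A(3)] second A(1) unfolding smooth_conic_def by blast
  qed
qed

text \<open>A point other than R1 is reached along its line to R1, and R1 itself along the
  tangent.\<close>

lemma pencil_conic_range:
  assumes q: "q \<noteq> 0" "q \<noteq> 1"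
  shows "pencil_conic q = range (conic_param q)"
proof (intro subset_antisym subsetI)
  fix P assume "P \<in> range (conic_param q)"
  then obtain t s where ts: "(t, s) \<noteq> (0, 0)" "P = conic_param q (quot t s)"
    using p1_cases by (metis imageE)
  have "bil (cmat q) (ypt q t s) (ypt q t s) = 0"
    unfolding ypt_def bil_combination[OF transpose_cmat] bil_dir
    using base_on_cmat[of 1] by (simp add: algebra_simps)
  then show "P \<in> pencil_conic q"
    by (simp add: ts conic_param_quot[OF q ts(1)] pencil_conic_eq[OF q] conic_points_abs ypt_nonzero[OF q ts(1)])
next
  fix P assume P: "P \<in> pencil_conic q"
  obtain p where p: "p \<noteq> 0" "P = abs_plane p" by (rule plane_cases)
  have on: "bil (cmat q) p p = 0" using P p by (simp add: pencil_conic_eq[OF q] conic_points_abs)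
  define t s where "t = p$2 - p$3" and "s = p$1 - 2 * p$3"
  have dec: "p = p$3 *s base 1 + 1 *s vector [s, t, 0]"
    by (simp add: t_def s_def base_simps vec_eq_iff forall_3)
  show "P \<in> range (conic_param q)"
  proof (cases "(t, s) = (0, 0)")
    case False
    have "bil (cmat q) p p = 2 * p$3 * beta_form q t s + gamma_form q t s"
      by (subst (1 2) dec, unfold bil_combination[OF transpose_cmat] bil_dir)
        (use base_on_cmat[of 1] in \<open>simp add: algebra_simps\<close>)
    then have e: "2 * p$3 * beta_form q t s + gamma_form q t s = 0" using on by simp
    have "cross (p$3 *s base 1 + 1 *s vector [s, t, 0]) (ypt q t s) =
        (2 * p$3 * beta_form q t s + gamma_form q t s) *s cross (base 1) (vector [s, t, 0])"
      unfolding ypt_def by (simp add: coords algebra_simps)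
    then have "cross p (ypt q t s) = 0" unfolding dec[symmetric] e by simp
    then have "P = conic_param q (quot t s)"
      using cross_eq_0_iff[OF p(1) ypt_nonzero[OF q False]] conic_param_quot[OF q False] p(2) by simp
    then show ?thesis by blast
  next
    case True
    \<comment> \<open>Here P is R1; the parameter is that of the tangent, where
      \<open>beta_form\<close> vanishes.\<close>
    let ?t = "5 * q + 4" and ?s = "2 * q + 4"
    note ts = tdir_nonzero[of q]
    have "beta_form q ?t ?s = 0" by (simp add: beta_form_def algebra_simps)
    then have y: "ypt q ?t ?s = (- gamma_form q ?t ?s) *s base 1"
      unfolding ypt_def by simp
    have pr: "p = p$3 *s base 1" using True by (simp add: t_def s_def base_simps vec_eq_iff forall_3)
    have "cross (p$3 *s base 1) (ypt q ?t ?s) = 0" unfolding y by (simp add: coords algebra_simps)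
    then have "P = conic_param q (quot ?t ?s)"
      using cross_eq_0_iff[OF p(1) ypt_nonzero[OF q ts]] conic_param_quot[OF q ts] p(2) pr[symmetric] by simp
    then show ?thesis by blast
  qed
qed

section \<open>The maps\<close>

lemma tau_map_abs:
  assumes "v \<noteq> 0"
  shows "tau_map (abs_plane v) = abs_plane (tau_coords v)"
proof -
  have "\<exists>c. c \<noteq> 0 \<and> v = c *s v" by (intro exI[of _ 1]) simp
  with assms show ?thesis by (intro tau_map.abs_eq) (auto simp: eq_onp_def)
qed

lemma pi_map_abs:
  assumes "v \<noteq> 0" "pi_coords v \<noteq> 0"
  shows "pi_map (abs_plane v) = Some (abs_plane (pi_coords v))"
proof -
  have "\<exists>c. c \<noteq> 0 \<and> v = c *s v" by (intro exI[of _ 1]) simp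
  with assms show ?thesis by (subst pi_map.abs_eq) (auto simp: eq_onp_def)
qed

section \<open>The parameter maps in homogeneous coordinates\<close>

lemma iota_quot:
  assumes "(t, s) \<noteq> (0, 0)"
  shows "iota (quot t s) = quot (19 * t - 23 * s) (16 * t - 19 * s)"
proof (cases "s = 0")
  case True
  then show ?thesis using assms quot_scale[of t 19 16] by (simp add: quot_def mult.commute)
next
  case False
  have "quot (s * (19 * (t / s) - 23)) (s * (16 * (t / s) - 19)) = quot (19 * (t / s) - 23) (16 * (t / s) - 19)"
    using False by (rule quot_scale)
  moreover have "s * (19 * (t / s) - 23) = 19 * t - 23 * s" "s * (16 * (t / s) - 19) = 16 * t - 19 * s"
    using False by (simp_all add: field_simps)
  moreover have "quot t s = Aff (t / s)" using False by (simp add: quot_def)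
  ultimately show ?thesis by simp
qed

definition beta_num :: "complex \<Rightarrow> complex \<Rightarrow> complex" where
  "beta_num t s = 44 * t^2 - 76 * t * s + 27 * s^2"

definition beta_den :: "complex \<Rightarrow> complex \<Rightarrow> complex" where
  "beta_den t s = 56 * t^2 - 120 * t * s + 62 * s^2"

lemma beta_quot:
  assumes "(t, s) \<noteq> (0, 0)"
  shows "beta (quot t s) = quot (beta_num t s) (beta_den t s)"
proof (cases "s = 0")
  case True
  then show ?thesis using assms quot_scale[of "t^2" 44 56]
    by (simp add: quot_def beta_num_def beta_den_def mult.commute)
next
  case False
  let ?u = "t / s"
  have "quot (s^2 * (44 * ?u^2 - 76 * ?u + 27)) (s^2 * (56 * ?u^2 - 120 * ?u + 62))
      = quot (44 * ?u^2 - 76 * ?u + 27) (56 * ?u^2 - 120 * ?u + 62)"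
    using False by (intro quot_scale) simp
  moreover have "s^2 * (44 * ?u^2 - 76 * ?u + 27) = beta_num t s" "s^2 * (56 * ?u^2 - 120 * ?u + 62) = beta_den t s"
    using False by (simp_all add: beta_num_def beta_den_def field_simps power2_eq_square)
  moreover have "quot t s = Aff ?u" using False by (simp add: quot_def)
  ultimately show ?thesis by simp
qed

lemma iota_nonzero:
  assumes "(t, s) \<noteq> (0, 0 :: complex)"
  shows "(19 * t - 23 * s, 16 * t - 19 * s) \<noteq> (0, 0)"
proof
  assume "(19 * t - 23 * s, 16 * t - 19 * s) = (0, 0)"
  then have e: "19 * t - 23 * s = 0" "16 * t - 19 * s = 0" by auto
  \<comment> \<open>Adjugate of the coefficient matrix, whose determinant is 7.\<close>
  have "7 * t = 23 * (16 * t - 19 * s) - 19 * (19 * t - 23 * s)"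
    "7 * s = 19 * (16 * t - 19 * s) - 16 * (19 * t - 23 * s)" by (simp_all add: algebra_simps)
  then show False using assms e by simp
qed

text \<open>The combination \<open>14 * beta_num t s - 11 * beta_den t s\<close> loses its
  \<open>t^2\<close> term and splits into linear factors, at whose nontrivial zeros
  \<open>beta_num\<close> is nonzero.\<close>

lemma beta_nonzero:
  assumes "(t, s) \<noteq> (0, 0)"
  shows "(beta_num t s, beta_den t s) \<noteq> (0, 0)"
proof
  assume "(beta_num t s, beta_den t s) = (0, 0)"
  then have e: "beta_num t s = 0" "beta_den t s = 0" by auto
  have "16 * s * (16 * t - 19 * s) = 14 * beta_num t s - 11 * beta_den t s"
    by (simp add: beta_num_def beta_den_def algebra_simps power2_eq_square)
  then consider "s = 0" | "16 * t = 19 * s" using e by auto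
  then show False
  proof cases
    case 1 then show ?thesis using e assms by (simp add: beta_num_def)
  next
    case 2
    have "256 * beta_num t s = 44 * (16 * t)^2 - 1216 * (16 * t) * s + 6912 * s^2"
      by (simp add: beta_num_def power2_eq_square algebra_simps)
    also have "\<dots> = - 308 * s^2" unfolding 2 by (simp add: power2_eq_square algebra_simps)
    finally have "s = 0" using e by simp
    with 2 assms show ?thesis by simp
  qed
qed

text \<open>The matrix of \<open>iota\<close> has trace 0 and determinant 7, so it squares to -7
  times the identity: \<open>iota\<close> is its own inverse.\<close>

lemma iota_surj: "surj iota"
proof -
  have "t \<in> range iota" for t
  proof -
    obtain a b where ab: "(a, b) \<noteq> (0, 0)" "t = quot a b" by (rule p1_cases)
    have "iota (quot (19 * a - 23 * b) (16 * a - 19 * b)) = quot (- 7 * a) (- 7 * b)"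
      unfolding iota_quot[OF iota_nonzero[OF ab(1)]] by (simp add: algebra_simps)
    also have "\<dots> = t" unfolding ab(2) by (rule quot_scale) simp
    finally show ?thesis by (metis rangeI)
  qed
  then show ?thesis by blast
qed

text \<open>Quadratic formula cleared of its denominator \<open>2 * a\<close>; for
  \<open>a = 0\<close> the zero is \<open>[1, 0]\<close>.\<close>

lemma binary_quadratic_zero:
  fixes a b c :: complex
  obtains t s where "(t, s) \<noteq> (0, 0)" "a * t^2 + b * t * s + c * s^2 = 0"
proof (cases "a = 0")
  case True
  then show ?thesis by (intro that[of 1 0]) simp_all
next
  case False
  let ?r = "csqrt (b^2 - 4 * a * c)"
  have "4 * a * (a * (?r - b)^2 + b * (?r - b) * (2 * a) + c * (2 * a)^2) = 4 * a^2 * (?r^2 - (b^2 - 4 * a * c))"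
    by (simp add: power2_eq_square algebra_simps)
  also have "\<dots> = 0" by simp
  finally show ?thesis using False by (intro that[of "?r - b" "2 * a"]) simp_all
qed

lemma quot_eqI:
  assumes "(a, b) \<noteq> (0, 0)" "(c, d) \<noteq> (0, 0)" "a * d = b * c"
  shows "quot a b = quot c d"
  using assms by (auto simp: quot_def field_simps)

text \<open>A preimage of \<open>[a, b]\<close> is a zero of the quadratic form
  \<open>b * beta_num t s - a * beta_den t s\<close>.\<close>

lemma beta_surj: "surj beta"
proof -
  have "u \<in> range beta" for u
  proof -
    obtain a b where ab: "(a, b) \<noteq> (0, 0)" "u = quot a b" by (rule p1_cases)
    obtain t s where ts: "(t, s) \<noteq> (0, 0)"
      "(44 * b - 56 * a) * t^2 + (120 * a - 76 * b) * t * s + (27 * b - 62 * a) * s^2 = 0"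
      by (rule binary_quadratic_zero)
    have "beta_num t s * b = beta_den t s * a"
      using ts(2) by (simp add: beta_num_def beta_den_def algebra_simps)
    then have "beta (quot t s) = u"
      unfolding beta_quot[OF ts(1)] ab(2) using beta_nonzero[OF ts(1)] ab(1) by (intro quot_eqI)
    then show ?thesis by blast
  qed
  then show ?thesis by blast
qed

section \<open>The two maps on the parametrised conic\<close>

lemmas ypt_coords = ypt_def beta_form_def gamma_form_def base_simps vec_eq_iff forall_3

text \<open>The factor is determined up to sign: \<open>tau_coords\<close> is an involution, and
  applying the matrix of \<open>iota\<close> twice multiplies the quadratic \<open>ypt\<close> by
  49.\<close>

lemma tau_ypt:
  "tau_coords (ypt (2/7) t s) = (- 1/7) *s ypt (2/7) (19 * t - 23 * s) (16 * t - 19 * s)"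
  by (simp add: ypt_coords tau_coords_def) (simp add: power2_eq_square field_simps)

text \<open>Both sides are quartic in \<open>t\<close> and \<open>s\<close>, each being a quadratic
  map after a quadratic one.\<close>

lemma pi_ypt:
  "pi_coords (ypt (2/7) t s) = (30/49) *s ypt (- 1/4) (beta_num t s) (beta_den t s)"
  by (simp add: ypt_coords pi_coords_def beta_num_def beta_den_def) (simp add: power2_eq_square field_simps)

lemma tau_conic_param: "tau_map (conic_param (2/7) t) = conic_param (2/7) (iota t)"
proof -
  obtain a b where ab: "(a, b) \<noteq> (0, 0)" "t = quot a b" by (rule p1_cases)
  have q: "2/7 \<noteq> (0::complex)" "2/7 \<noteq> (1::complex)" by auto
  note n = iota_nonzero[OF ab(1)]
  have "tau_map (conic_param (2/7) t) = abs_plane ((- 1/7) *s ypt (2/7) (19 * a - 23 * b) (16 * a - 19 * b))"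
    unfolding ab(2) conic_param_quot[OF q ab(1)] tau_map_abs[OF ypt_nonzero[OF q ab(1)]] tau_ypt ..
  also have "\<dots> = abs_plane (ypt (2/7) (19 * a - 23 * b) (16 * a - 19 * b))"
    by (rule abs_plane_smult) (use ypt_nonzero[OF q n] in simp_all)
  also have "\<dots> = conic_param (2/7) (iota t)"
    unfolding ab(2) iota_quot[OF ab(1)] conic_param_quot[OF q n] ..
  finally show ?thesis .
qed

lemma pi_conic_param: "pi_map (conic_param (2/7) t) = Some (conic_param (- 1/4) (beta t))"
proof -
  obtain a b where ab: "(a, b) \<noteq> (0, 0)" "t = quot a b" by (rule p1_cases)
  have q: "2/7 \<noteq> (0::complex)" "2/7 \<noteq> (1::complex)" and q': "- 1/4 \<noteq> (0::complex)" "- 1/4 \<noteq> (1::complex)"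
    by (auto simp: complex_eq_iff)
  note y = ypt_nonzero[OF q' beta_nonzero[OF ab(1)]]
  \<comment> \<open>The conic avoids the points of indeterminacy, so the value \<open>None\<close>
    does not occur.\<close>
  have "pi_coords (ypt (2/7) a b) \<noteq> 0" unfolding pi_ypt using y by simp
  then have "pi_map (conic_param (2/7) t) = Some (abs_plane ((30/49) *s ypt (- 1/4) (beta_num a b) (beta_den a b)))"
    unfolding ab(2) conic_param_quot[OF q ab(1)] pi_ypt[symmetric] by (intro pi_map_abs ypt_nonzero[OF q ab(1)])
  also have "abs_plane ((30/49) *s ypt (- 1/4) (beta_num a b) (beta_den a b)) =
      abs_plane (ypt (- 1/4) (beta_num a b) (beta_den a b))"
    by (rule abs_plane_smult) (use y in simp_all)
  also have "\<dots> = conic_param (- 1/4) (beta t)"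
    unfolding ab(2) beta_quot[OF ab(1)] conic_param_quot[OF q' beta_nonzero[OF ab(1)]] ..
  finally show ?thesis .
qed

theorem theorem5p1:
  shows "tau_map ` pencil_conic (2/7) = pencil_conic (2/7)
    \<and> pi_map ` pencil_conic (2/7) = Some ` pencil_conic (- 1/4)
    \<and> (\<forall>t. tau_map (conic_param (2/7) t) = conic_param (2/7) (iota t))
    \<and> (\<forall>t. pi_map (conic_param (2/7) t) = Some (conic_param (- 1/4) (beta t)))"
proof -
  have C: "pencil_conic (2/7) = range (conic_param (2/7))" "pencil_conic (- 1/4) = range (conic_param (- 1/4))"
    by (rule pencil_conic_range; simp add: complex_eq_iff)+
  have "tau_map ` pencil_conic (2/7) = conic_param (2/7) ` range iota"
    unfolding C image_image tau_conic_param ..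
  moreover have "pi_map ` pencil_conic (2/7) = Some ` conic_param (- 1/4) ` range beta"
    unfolding C image_image pi_conic_param ..
  ultimately show ?thesis
    using tau_conic_param pi_conic_param unfolding C iota_surj beta_surj by blast
qed

end
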